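(* Fix integers $n$ and $k$ with $1\le k\le n-1$, and put $D=\dim\operatorname{Sym}_n(\mathbb R)=\frac{n(n+1)}2$. The least integer $N$ for which there exist $k$-dimensional linear subspaces $L_1,\ldots,L_N$ of $\mathbb R^n$ with the property $$\text{whenever }\mathbf e_1,\ldots,\mathbf e_n\in\mathbb R^n\text{ are unit vectors with }\sum_{i=1}^{n}\lVert Q_j\mathbf e_i\rVert^2=k\text{ for all }1\le j\le N,\text{ the vectors }\mathbf e_1,\ldots,\mathbf e_n\text{ form an orthonormal basis of }\mathbb R^n,$$ where $Q_j$ denotes the orthogonal projection onto $L_j$, is $$N=D-1=\frac{n(n+1)}2-1.$$
   Context: $\operatorname{Sym}_n(\mathbb R)$ is the vector space of real symmetric $n\times n$ matrices; $\mathbb R^n$ carries its standard Euclidean structure. *)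

theory Defs
  imports "HOL-Analysis.Analysis"
begin

definition Sym_matrices :: "(real ^ 'n ^ 'n) set" where
  "Sym_matrices = {A. transpose A = A}"

text \<open>Meaningful when \<open>L\<close> is a subspace; then the point exists and is unique, see
  \<open>orth_proj_in\<close> and \<open>orth_proj_unique\<close>.\<close>

definition orth_proj :: "'a::euclidean_space set \<Rightarrow> 'a \<Rightarrow> 'a" where
  "orth_proj L x = (THE y. y \<in> L \<and> (\<forall>z\<in>L. orthogonal (x - y) z))"

lemma orth_proj_unique:
  fixes L :: "'a::euclidean_space set"
  assumes L: "subspace L" and y: "y \<in> L" "\<And>z. z \<in> L \<Longrightarrow> orthogonal (x - y) z"
  shows "orth_proj L x = y"
  unfolding orth_proj_def
proof (rule the_equality)
  show "y \<in> L \<and> (\<forall>z\<in>L. orthogonal (x - y) z)"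
    using y by blast
next
  fix w assume w: "w \<in> L \<and> (\<forall>z\<in>L. orthogonal (x - w) z)"
  have d: "w - y \<in> L"
    using w y(1) L by (simp add: subspace_diff)
  have "(w - y) \<bullet> (w - y) = (x - y) \<bullet> (w - y) - (x - w) \<bullet> (w - y)"
    by (simp add: inner_diff_left)
  also have "\<dots> = 0"
    using w y(2)[OF d] d by (simp add: orthogonal_def)
  finally show "w = y" by simp
qed

lemma orth_proj_in:
  fixes L :: "'a::euclidean_space set"
  assumes L: "subspace L"
  shows "orth_proj L x \<in> L" and "z \<in> L \<Longrightarrow> orthogonal (x - orth_proj L x) z"
proof -
  obtain y w where yw: "y \<in> span L" "\<And>v. v \<in> span L \<Longrightarrow> orthogonal w v" "x = y + w"
    using orthogonal_subspace_decomp_exists[of L x] by metis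
  have s: "span L = L" using L by (simp add: span_eq_iff)
  have "orth_proj L x = y"
    by (rule orth_proj_unique[OF L]) (use yw s in auto)
  then show "orth_proj L x \<in> L" and "z \<in> L \<Longrightarrow> orthogonal (x - orth_proj L x) z"
    using yw s by auto
qed

definition orthonormal_basis :: "('i \<Rightarrow> 'a::euclidean_space) \<Rightarrow> bool" where
  "orthonormal_basis e \<longleftrightarrow>
     (\<forall>i. norm (e i) = 1) \<and> (\<forall>i j. i \<noteq> j \<longrightarrow> orthogonal (e i) (e j)) \<and> span (range e) = UNIV"

text \<open>The \<open>n\<close>-tuple of vectors \<open>e\<close> is indexed by the type \<open>'n\<close>, which has \<open>n\<close> elements.\<close>

definition forces_orthonormal_basis :: "nat \<Rightarrow> nat \<Rightarrow> (nat \<Rightarrow> (real ^ 'n) set) \<Rightarrow> bool" where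
  "forces_orthonormal_basis k N L \<longleftrightarrow>
     (\<forall>e :: 'n \<Rightarrow> real ^ 'n.
        (\<forall>i. norm (e i) = 1) \<and>
        (\<forall>j\<in>{1..N}. (\<Sum>i\<in>UNIV. (norm (orth_proj (L j) (e i)))\<^sup>2) = real k)
        \<longrightarrow> orthonormal_basis e)"

text \<open>There are \<open>k\<close>-dimensional subspaces \<open>L 1, \<dots>, L N\<close> of \<open>real ^ 'n\<close> with the forcing
  property; the argument of type \<open>'n itself\<close> only fixes the dimension. The subspaces need not
  be distinct.\<close>

definition admissible :: "'n::finite itself \<Rightarrow> nat \<Rightarrow> nat \<Rightarrow> bool" where
  "admissible _ k N \<longleftrightarrow>
     (\<exists>L :: nat \<Rightarrow> (real ^ 'n) set.
        (\<forall>j\<in>{1..N}. subspace (L j) \<and> dim (L j) = k) \<and> forces_orthonormal_basis k N L)"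

end

theory Submission
  imports Defs
begin

text \<open>
  Write \<open>dyad x\<close> for the rank-one matrix \<open>x x\<^sup>T\<close> and use the trace inner product on matrices. An
  \<open>n\<close>-tuple \<open>e\<close> of unit vectors enters the problem only through \<open>S = \<Sum>\<^sub>i dyad (e i)\<close>: the sum of the
  squared norms of the projections to \<open>L j\<close> is \<open>M j \<bullet> S\<close>, where \<open>M j\<close> is the matrix of the projection,
  and \<open>e\<close> is an orthonormal basis exactly when \<open>S\<close> is the identity
  (\<open>orthonormal_basis_iff_sum_dyads\<close>). Moreover every positive semidefinite matrix of trace \<open>n\<close> is
  such an \<open>S\<close> (\<open>psd_eq_sum_unit_dyads\<close>). As \<open>M j\<close> has trace \<open>k\<close>, the hypotheses on \<open>e\<close> say that
  \<open>S - 1\<close> is orthogonal to \<open>1\<close> and to all the \<open>M j\<close>.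

  Hence the subspaces force orthonormality if and only if \<open>1, M 1, \<dots>, M N\<close> span the space of
  symmetric matrices (\<open>forces_iff_span\<close>). If they span, then \<open>S - 1\<close> is orthogonal to itself. If they
  do not, some symmetric \<open>T \<noteq> 0\<close> is orthogonal to all of them, and \<open>1 + c T\<close> with a small \<open>c > 0\<close> is
  positive semidefinite of trace \<open>n\<close>, so it comes from unit vectors that satisfy the conditions
  without being orthonormal.

  Spanning takes at least \<open>D\<close> matrices, so \<open>N + 1 \<ge> D\<close>. Conversely, the projections of rank \<open>k\<close>
  alone span the symmetric matrices when \<open>1 \<le> k < n\<close> (\<open>span_proj_matrices\<close>), so \<open>{1}\<close> can be
  completed to a basis by \<open>D - 1\<close> of them.
\<close>

section \<open>Dyads\<close>

definition dyad :: "real ^ 'n \<Rightarrow> real ^ 'n ^ 'n" where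
  "dyad x = (\<chi> i j. x $ i * x $ j)"

lemma inner_dyad: "A \<bullet> dyad x = x \<bullet> (A *v x)"
  by (simp add: dyad_def inner_vec_def matrix_vector_mult_def sum_distrib_left mult_ac)

lemma dyad_mult_vec: "dyad x *v y = (x \<bullet> y) *\<^sub>R x"
  by (simp add: dyad_def inner_vec_def matrix_vector_mult_def vec_eq_iff sum_distrib_left
      sum_distrib_right mult_ac)

lemma dyad_inner_dyad: "dyad x \<bullet> dyad y = (x \<bullet> y)\<^sup>2"
  by (simp add: inner_dyad dyad_mult_vec power2_eq_square inner_commute)

lemma mat_1_inner_dyad: "mat 1 \<bullet> dyad x = (norm x)\<^sup>2"
  by (simp add: inner_dyad power2_norm_eq_inner)

lemma sum_dyads_inner_mat_1: "(\<Sum>i\<in>I. dyad (v i)) \<bullet> mat 1 = (\<Sum>i\<in>I. (norm (v i))\<^sup>2)"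
  by (subst inner_commute) (simp add: inner_sum_right mat_1_inner_dyad)

lemma norm_dyad: "norm (dyad x) = (norm x)\<^sup>2"
  by (simp add: norm_eq_sqrt_inner[of "dyad x"] dyad_inner_dyad power2_norm_eq_inner)

lemma dyad_scaleR: "dyad (c *\<^sub>R x) = c\<^sup>2 *\<^sub>R dyad x"
  by (simp add: dyad_def vec_eq_iff power2_eq_square mult_ac)

lemma sum_mult_vec: "(\<Sum>i\<in>I. A i) *v x = (\<Sum>i\<in>I. A i *v x)"
  by (induction I rule: infinite_finite_induct) (simp_all add: matrix_vector_mult_add_rdistrib)

text \<open>The sum of dyads over a tuple of vectors is unchanged when two of the vectors are mixed by a
  plane rotation, since it is \<open>E E\<^sup>T\<close> for the matrix \<open>E\<close> with these vectors as columns.\<close>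

lemma dyad_rotate:
  assumes "c\<^sup>2 + s\<^sup>2 = 1"
  shows "dyad (c *\<^sub>R x + s *\<^sub>R y) + dyad (c *\<^sub>R y - s *\<^sub>R x) = dyad x + dyad y"
proof -
  have "(c * a + s * b) * (c * a' + s * b') + (c * b - s * a) * (c * b' - s * a') = a * a' + b * b'"
    for a a' b b'
  proof -
    have "(c * a + s * b) * (c * a' + s * b') + (c * b - s * a) * (c * b' - s * a')
        = (c\<^sup>2 + s\<^sup>2) * (a * a' + b * b')"
      by (simp add: algebra_simps power2_eq_square)
    then show ?thesis using assms by simp
  qed
  then show ?thesis
    by (simp add: dyad_def vec_eq_iff)
qed

section \<open>Symmetric matrices\<close>

lemma subspace_Sym_matrices: "subspace Sym_matrices"
  by (auto simp: subspace_def Sym_matrices_def transpose_def vec_eq_iff)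

lemma dyad_in_Sym: "dyad x \<in> Sym_matrices"
  by (simp add: Sym_matrices_def dyad_def transpose_def mult.commute)

lemma mat_1_in_Sym: "mat 1 \<in> Sym_matrices"
  by (simp add: Sym_matrices_def transpose_mat)

lemma Sym_self_adjoint:
  assumes "A \<in> Sym_matrices"
  shows "x \<bullet> (A *v y) = (A *v x) \<bullet> y"
  using assms
  by (metis (mono_tags, lifting) Sym_matrices_def dot_lmul_matrix mem_Collect_eq
      transpose_matrix_vector)

lemma inner_dyad_add:
  assumes "A \<in> Sym_matrices"
  shows "A \<bullet> dyad (x + y) = A \<bullet> dyad x + 2 * (x \<bullet> (A *v y)) + A \<bullet> dyad y"
  using Sym_self_adjoint[OF assms, of y x]
  by (simp add: inner_dyad matrix_vector_right_distrib inner_add_left inner_add_right inner_commute)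

text \<open>Polarization: a symmetric matrix is determined by its quadratic form.\<close>

lemma Sym_eq_0_if_orthogonal_dyads:
  assumes A: "A \<in> Sym_matrices" and 0: "\<And>x. A \<bullet> dyad x = 0"
  shows "A = 0"
proof -
  have "x \<bullet> (A *v y) = 0" for x y
    using inner_dyad_add[OF A, of x y] 0 by simp
  then have "A *v y = 0" for y
    using inner_eq_zero_iff by blast
  then show ?thesis
    by (simp add: matrix_eq)
qed

text \<open>The index type carries no order, so instead of the pairs \<open>i \<le> j\<close> the standard basis of the
  symmetric matrices is indexed by the sets \<open>{i, j}\<close>, that is, by the subsets with one or two
  elements.\<close>

lemma dim_Sym_matrices:
  "dim (Sym_matrices :: (real ^ 'n ^ 'n) set) = CARD('n) * (CARD('n) + 1) div 2"
proof -
  define P where "P = {s :: 'n set. card s = 1} \<union> {s. card s = 2}"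
  define E :: "'n set \<Rightarrow> real ^ 'n ^ 'n" where
    "E s = (\<chi> i j. if {i, j} = s then 1 else 0)" for s
  have pair: "{i, j} \<in> P" for i j
    by (cases "i = j") (auto simp: P_def)
  have pairE: "\<exists>i j. s = {i, j}" if "s \<in> P" for s
    using that by (auto simp: P_def card_1_singleton_iff card_2_iff)
  have orth: "E s \<bullet> E t = 0" if "s \<noteq> t" for s t
    unfolding inner_vec_def E_def using that by (auto intro!: sum.neutral split: if_splits)
  have nz: "E s \<noteq> 0" if "s \<in> P" for s
    using pairE[OF that] by (auto simp: E_def vec_eq_iff)
  have inj: "inj_on E P"
    using orth nz by (metis inj_onI inner_eq_zero_iff)
  have ind: "independent (E ` P)"
  proof (rule pairwise_orthogonal_independent)
    show "pairwise orthogonal (E ` P)"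
      by (rule pairwise_imageI) (simp add: orthogonal_def orth)
    show "0 \<notin> E ` P"
      using nz by (metis imageE)
  qed
  have sub: "E ` P \<subseteq> Sym_matrices"
    by (auto simp: E_def Sym_matrices_def transpose_def vec_eq_iff insert_commute)
  have span: "Sym_matrices \<subseteq> span (E ` P)"
  proof
    fix A :: "real ^ 'n ^ 'n" assume "A \<in> Sym_matrices"
    then have sym: "A $ i $ j = A $ j $ i" for i j
      by (auto simp: Sym_matrices_def transpose_def vec_eq_iff)
    \<comment> \<open>The entry of \<open>A\<close> at \<open>(i, j)\<close> depends only on \<open>{i, j}\<close>.\<close>
    define c where "c s = (SOME r. \<exists>i j. s = {i, j} \<and> r = A $ i $ j)" for s
    have c: "c {i, j} = A $ i $ j" for i j
      unfolding c_def
      by (rule some1_equality) (auto simp: doubleton_eq_iff sym)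
    have "A = (\<Sum>s\<in>P. c s *\<^sub>R E s)"
    proof -
      have "(\<Sum>s\<in>P. c s *\<^sub>R E s) $ i $ j = A $ i $ j" for i j
      proof -
        have "(\<Sum>s\<in>P. c s *\<^sub>R E s) $ i $ j = (\<Sum>s\<in>P. c s * (if {i, j} = s then 1 else 0))"
          by (simp add: E_def)
        also have "\<dots> = (\<Sum>s\<in>P. if {i, j} = s then c s else 0)"
          by (intro sum.cong) auto
        finally show ?thesis
          using pair by (simp add: c)
      qed
      then show ?thesis
        by (simp add: vec_eq_iff)
    qed
    also have "\<dots> \<in> span (E ` P)"
      by (intro span_sum span_scale span_base imageI)
    finally show "A \<in> span (E ` P)" .
  qed
  have "dim (Sym_matrices :: (real ^ 'n ^ 'n) set) = card (E ` P)"
    using dim_unique[OF sub span ind refl] .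
  also have "\<dots> = card P"
    by (rule card_image[OF inj])
  also have "\<dots> = CARD('n) + (CARD('n) choose 2)"
    using n_subsets[of "UNIV :: 'n set" 1] n_subsets[of "UNIV :: 'n set" 2]
    unfolding P_def by (subst card_Un_disjoint) auto
  also have "\<dots> = CARD('n) * (CARD('n) + 1) div 2"
  proof -
    have "m * (m + 1) = m * (m - 1) + m * 2" for m :: nat
      by (cases m) auto
    then show ?thesis
      by (simp only: choose_two)
  qed
  finally show ?thesis .
qed

section \<open>Unit vectors with a prescribed sum of dyads\<close>

text \<open>Lagrange's completion of squares. If the form is not zero, then it is positive at some \<open>w\<close>, and
  subtracting the square of the linear form \<open>x \<mapsto> (A w \<bullet> x) / sqrt q\<close>, with \<open>q\<close> its value at \<open>w\<close>,
  leaves a positive semidefinite form by the Cauchy-Schwarz argument. The kernel gains the vector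
  \<open>w\<close>, so at most as many steps as the codimension of the kernel are needed.\<close>

lemma psd_eq_sum_dyads_aux:
  fixes A :: "real ^ 'n ^ 'n"
  assumes "A \<in> Sym_matrices" "\<And>x. 0 \<le> A \<bullet> dyad x" "CARD('n) \<le> dim {x. A *v x = 0} + m"
  shows "\<exists>v :: nat \<Rightarrow> real ^ 'n. A = (\<Sum>i<m. dyad (v i))"
  using assms
proof (induction m arbitrary: A)
  case 0
  have "subspace {x. A *v x = 0}"
    by (auto simp: subspace_def matrix_vector_right_distrib matrix_vector_mult_scaleR)
  moreover have "dim {x. A *v x = 0} = DIM(real ^ 'n)"
    using 0(3) dim_subset_UNIV[of "{x. A *v x = 0}"] by simp
  ultimately have "{x. A *v x = 0} = UNIV"
    by (metis dim_eq_full span_eq_iff)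
  then show ?case
    by (auto simp: matrix_eq)
next
  case (Suc m)
  show ?case
  proof (cases "A = 0")
    case True
    have "dyad (0 :: real ^ 'n) = 0" by (simp add: dyad_def vec_eq_iff)
    with True show ?thesis by (intro exI[of _ "\<lambda>_. 0"]) simp
  next
    case False
    then obtain w where "A \<bullet> dyad w \<noteq> 0"
      using Sym_eq_0_if_orthogonal_dyads[OF Suc.prems(1)] by blast
    then have q: "A \<bullet> dyad w > 0"
      using Suc.prems(2)[of w] by linarith
    define q where "q = A \<bullet> dyad w"
    have q0: "q > 0" using q by (simp add: q_def)
    define y where "y = A *v w"
    define u where "u = (1 / sqrt q) *\<^sub>R y"
    define A' where "A' = A - dyad u"
    have du: "dyad u = (1 / q) *\<^sub>R dyad y"
      using q0 by (simp add: u_def dyad_scaleR power_divide)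
    have yw: "y \<bullet> w = q"
      by (simp add: y_def q_def inner_dyad inner_commute)
    have A'_mult: "A' *v x = A *v x - ((y \<bullet> x) / q) *\<^sub>R y" for x
      by (simp add: A'_def du matrix_vector_mult_diff_rdistrib scaleR_matrix_vector_assoc[symmetric]
          dyad_mult_vec)
    have "A' \<in> Sym_matrices"
      unfolding A'_def
      by (intro subspace_diff[OF subspace_Sym_matrices] Suc.prems(1) dyad_in_Sym)
    moreover have "0 \<le> A' \<bullet> dyad x" for x
    proof -
      \<comment> \<open>This \<open>t\<close> minimizes the form on the line through \<open>x\<close> with direction \<open>w\<close>.\<close>
      define t where "t = (y \<bullet> x) / q"
      have "0 \<le> A \<bullet> dyad (x + (- t) *\<^sub>R w)"
        by (rule Suc.prems(2))
      also have "\<dots> = A \<bullet> dyad x - 2 * t * (y \<bullet> x) + t\<^sup>2 * q"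
        unfolding inner_dyad_add[OF Suc.prems(1)] dyad_scaleR matrix_vector_mult_scaleR
        by (simp add: q_def y_def inner_commute[of x])
      also have "\<dots> = A \<bullet> dyad x - (y \<bullet> x)\<^sup>2 / q"
        using q0 by (simp add: t_def power2_eq_square field_simps)
      also have "\<dots> = A' \<bullet> dyad x"
        by (simp add: A'_def du inner_diff_left dyad_inner_dyad)
      finally show ?thesis .
    qed
    moreover have "CARD('n) \<le> dim {x. A' *v x = 0} + m"
    proof -
      have sub: "subspace {x. M *v x = 0}" for M :: "real ^ 'n ^ 'n"
        by (auto simp: subspace_def matrix_vector_right_distrib matrix_vector_mult_scaleR)
      have "A' *v x = 0" if "A *v x = 0" for x
        using that Sym_self_adjoint[OF Suc.prems(1), of w x] by (simp add: A'_mult y_def)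
      moreover have "A' *v w = 0"
        using q0 by (simp add: A'_mult yw) (simp add: y_def)
      moreover have "A *v w \<noteq> 0"
        using q by (auto simp: inner_dyad)
      ultimately have "{x. A *v x = 0} \<subset> {x. A' *v x = 0}"
        by blast
      then have "dim {x. A *v x = 0} < dim {x. A' *v x = 0}"
        by (intro dim_psubset) (simp add: span_eq_iff[THEN iffD2, OF sub])
      then show ?thesis
        using Suc.prems(3) by linarith
    qed
    ultimately obtain v :: "nat \<Rightarrow> real ^ 'n" where v: "A' = (\<Sum>i<m. dyad (v i))"
      using Suc.IH[of A'] by blast
    have "A = (\<Sum>i<Suc m. dyad ((v(m := u)) i))"
      using v by (simp add: A'_def algebra_simps)
    then show ?thesis by blast
  qed
qed

lemma psd_eq_sum_dyads:
  fixes A :: "real ^ 'n ^ 'n"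
  assumes "A \<in> Sym_matrices" "\<And>x. 0 \<le> A \<bullet> dyad x"
  obtains v :: "'n \<Rightarrow> real ^ 'n" where "A = (\<Sum>i\<in>UNIV. dyad (v i))"
proof -
  obtain v :: "nat \<Rightarrow> real ^ 'n" where v: "A = (\<Sum>i<CARD('n). dyad (v i))"
    using psd_eq_sum_dyads_aux[OF assms, of "CARD('n)"] by auto
  obtain h :: "'n \<Rightarrow> nat" where h: "bij_betw h UNIV {..<CARD('n)}"
    using ex_bij_betw_finite_nat[of "UNIV :: 'n set"] by (auto simp: lessThan_atLeast0)
  have "A = (\<Sum>i\<in>UNIV. dyad (v (h i)))"
    unfolding v by (rule sum.reindex_bij_betw[OF h, symmetric])
  then show thesis by (rule that)
qed

lemma rotate_to_unit_vector:
  fixes x y :: "'a::real_normed_vector"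
  assumes "norm x < 1" "norm y > 1"
  obtains c s :: real where "c\<^sup>2 + s\<^sup>2 = 1" "norm (c *\<^sub>R x + s *\<^sub>R y) = 1"
proof -
  have "\<exists>t\<ge>0. t \<le> pi / 2 \<and> norm (cos t *\<^sub>R x + sin t *\<^sub>R y) = 1"
    by (rule IVT') (use assms in \<open>auto intro!: continuous_intros\<close>)
  then show thesis
    using that by (metis sin_cos_squared_add2)
qed

text \<open>If the mean of the squared norms is \<open>1\<close> but not all norms are \<open>1\<close>, then one vector is too short
  and another too long. By the intermediate value theorem, a rotation of this pair gives the first
  one norm \<open>1\<close>. It keeps the sum of dyads, hence also its trace, the sum of the squared norms, so
  the argument can be repeated with fewer vectors that are not unit vectors.\<close>

lemma unit_vectors_same_sum_dyads:
  fixes v :: "'i::finite \<Rightarrow> real ^ 'n"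
  assumes "(\<Sum>i\<in>UNIV. (norm (v i))\<^sup>2) = CARD('i)"
  shows "\<exists>e :: 'i \<Rightarrow> real ^ 'n.
    (\<forall>i. norm (e i) = 1) \<and> (\<Sum>i\<in>UNIV. dyad (e i)) = (\<Sum>i\<in>UNIV. dyad (v i))"
  using assms
proof (induction "card {i. norm (v i) \<noteq> 1}" arbitrary: v rule: less_induct)
  case less
  show ?case
  proof (cases "\<forall>i. norm (v i) = 1")
    case True
    then show ?thesis by blast
  next
    case False
    have sum0: "(\<Sum>i\<in>UNIV. (norm (v i))\<^sup>2 - 1) = 0"
      using less.prems by (simp add: sum_subtractf)
    have "\<exists>i. norm (v i) < 1"
    proof (rule ccontr)
      assume "\<not> ?thesis"
      then have "0 \<le> (norm (v i))\<^sup>2 - 1" for i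
        by (simp add: not_less)
      then have "(norm (v i))\<^sup>2 - 1 = 0" for i
        using sum0 by (simp add: sum_nonneg_eq_0_iff)
      then show False
        using False by (simp add: power2_eq_1_iff)
          (metis norm_ge_zero not_one_le_zero neg_0_le_iff_le)
    qed
    then obtain i where i: "norm (v i) < 1" by blast
    have "\<exists>j. norm (v j) > 1"
    proof (rule ccontr)
      assume "\<not> ?thesis"
      then have le: "(norm (v j))\<^sup>2 - 1 \<le> 0" for j
        by (simp add: not_less power_le_one)
      have "(\<Sum>i\<in>UNIV. (norm (v i))\<^sup>2 - 1) < (\<Sum>i\<in>(UNIV :: 'i set). 0)"
        using i le by (intro sum_strict_mono_ex1) (auto simp: abs_square_less_1 intro!: exI[of _ i])
      then show False
        using sum0 by simp
    qed
    then obtain j where j: "norm (v j) > 1" by blast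
    have ij: "i \<noteq> j" using i j by auto
    obtain c s where cs: "c\<^sup>2 + s\<^sup>2 = 1" "norm (c *\<^sub>R v i + s *\<^sub>R v j) = 1"
      using rotate_to_unit_vector[OF i j] .
    define v' where "v' = v(i := c *\<^sub>R v i + s *\<^sub>R v j, j := c *\<^sub>R v j - s *\<^sub>R v i)"
    have split: "(\<Sum>l\<in>UNIV. f (u l)) = f (u i) + f (u j) + (\<Sum>l\<in>UNIV - {i, j}. f (u l))"
      for f :: "real ^ 'n \<Rightarrow> real ^ 'n ^ 'n" and u :: "'i \<Rightarrow> real ^ 'n"
    proof -
      have "(\<Sum>l\<in>UNIV. f (u l)) = (\<Sum>l\<in>UNIV - {i, j}. f (u l)) + (\<Sum>l\<in>{i, j}. f (u l))"
        by (rule sum.subset_diff) auto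
      then show ?thesis using ij by (simp add: add.commute)
    qed
    have same: "(\<Sum>l\<in>UNIV. dyad (v' l)) = (\<Sum>l\<in>UNIV. dyad (v l))"
      unfolding split[of dyad] using ij dyad_rotate[OF cs(1), of "v i" "v j"]
      by (simp add: v'_def)
    have "(\<Sum>l\<in>UNIV. (norm (v' l))\<^sup>2) = mat 1 \<bullet> (\<Sum>l\<in>UNIV. dyad (v' l))"
      by (simp add: inner_sum_right mat_1_inner_dyad)
    also have "\<dots> = CARD('i)"
      unfolding same using less.prems by (simp add: inner_sum_right mat_1_inner_dyad)
    finally have tr: "(\<Sum>l\<in>UNIV. (norm (v' l))\<^sup>2) = CARD('i)" .
    have "{l. norm (v' l) \<noteq> 1} \<subseteq> {l. norm (v l) \<noteq> 1} - {i}"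
    proof
      fix l assume "l \<in> {l. norm (v' l) \<noteq> 1}"
      then have l: "norm (v' l) \<noteq> 1" by simp
      have "norm (v' i) = 1" using ij cs(2) by (simp add: v'_def)
      then have "l \<noteq> i" using l by blast
      moreover have "norm (v l) \<noteq> 1"
        using l j \<open>l \<noteq> i\<close> by (cases "l = j") (simp_all add: v'_def)
      ultimately show "l \<in> {l. norm (v l) \<noteq> 1} - {i}" by simp
    qed
    then have "{l. norm (v' l) \<noteq> 1} \<subset> {l. norm (v l) \<noteq> 1}"
      using i by auto
    then have "card {l. norm (v' l) \<noteq> 1} < card {l. norm (v l) \<noteq> 1}"
      by (intro psubset_card_mono) auto
    from less.hyps[OF this tr] show ?thesis
      unfolding same .
  qed
qed

lemma psd_eq_sum_unit_dyads:
  fixes A :: "real ^ 'n ^ 'n"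
  assumes "A \<in> Sym_matrices" "\<And>x. 0 \<le> A \<bullet> dyad x" "A \<bullet> mat 1 = CARD('n)"
  obtains e :: "'n \<Rightarrow> real ^ 'n" where "\<And>i. norm (e i) = 1" "A = (\<Sum>i\<in>UNIV. dyad (e i))"
proof -
  obtain v :: "'n \<Rightarrow> real ^ 'n" where v: "A = (\<Sum>i\<in>UNIV. dyad (v i))"
    using psd_eq_sum_dyads[OF assms(1,2)] .
  have "(\<Sum>i\<in>UNIV. (norm (v i))\<^sup>2) = A \<bullet> mat 1"
    by (simp only: v sum_dyads_inner_mat_1)
  then show thesis
    using unit_vectors_same_sum_dyads[of v] assms(3) that v by metis
qed

text \<open>The identity matrix as a sum of dyads is the expansion \<open>x = \<Sum>\<^sub>i (e i \<bullet> x) e i\<close>. Conversely, it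
  makes \<open>1\<close>, the squared norm of \<open>e j\<close>, the sum of the squares of all \<open>e i \<bullet> e j\<close>; the term \<open>i = j\<close>
  is already \<open>1\<close>, so the others vanish.\<close>

lemma orthonormal_basis_iff_sum_dyads:
  fixes e :: "'n \<Rightarrow> real ^ 'n"
  assumes unit: "\<And>i. norm (e i) = 1"
  shows "orthonormal_basis e \<longleftrightarrow> (\<Sum>i\<in>UNIV. dyad (e i)) = mat 1"
proof -
  have mult: "(\<Sum>i\<in>UNIV. dyad (e i)) *v x = (\<Sum>i\<in>UNIV. (e i \<bullet> x) *\<^sub>R e i)" for x
    by (simp add: sum_mult_vec dyad_mult_vec)
  show ?thesis
  proof
    assume e: "orthonormal_basis e"
    have 1: "(\<Sum>i\<in>UNIV. dyad (e i)) *v e j = e j" for j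
    proof -
      have "(\<Sum>i\<in>UNIV. (e i \<bullet> e j) *\<^sub>R e i) = (\<Sum>i\<in>UNIV. if i = j then e j else 0)"
        using e by (intro sum.cong) (auto simp: orthonormal_basis_def orthogonal_def norm_eq_1)
      then show ?thesis by (simp add: mult)
    qed
    have "(\<Sum>i\<in>UNIV. dyad (e i)) *v x = x" for x
    proof (rule linear_eq_on_span[where B = "range e" and g = "\<lambda>x. x"])
      show "x \<in> span (range e)" using e by (simp add: orthonormal_basis_def)
    qed (use 1 in \<open>auto simp: linear_ident\<close>)
    then show "(\<Sum>i\<in>UNIV. dyad (e i)) = mat 1"
      by (simp add: matrix_eq)
  next
    assume S: "(\<Sum>i\<in>UNIV. dyad (e i)) = mat 1"
    have ex: "x = (\<Sum>i\<in>UNIV. (e i \<bullet> x) *\<^sub>R e i)" for x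
      using mult[of x] by (simp add: S)
    have "x \<in> span (range e)" for x
      by (subst ex) (intro span_sum span_scale span_base rangeI)
    moreover have "e i \<bullet> e j = 0" if "i \<noteq> j" for i j
    proof -
      have "1 = mat 1 \<bullet> dyad (e j)"
        by (simp add: mat_1_inner_dyad unit)
      also have "\<dots> = (\<Sum>l\<in>UNIV. (e l \<bullet> e j)\<^sup>2)"
        by (simp add: S[symmetric] inner_sum_left dyad_inner_dyad)
      also have "\<dots> = 1 + (\<Sum>l\<in>UNIV - {j}. (e l \<bullet> e j)\<^sup>2)"
        using unit[of j] by (subst sum.remove[of _ j]) (auto simp: norm_eq_1)
      finally have "(\<Sum>l\<in>UNIV - {j}. (e l \<bullet> e j)\<^sup>2) = 0" by simp
      then show ?thesis
        using that by (simp add: sum_nonneg_eq_0_iff)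
    qed
    ultimately show "orthonormal_basis e"
      using unit by (auto simp: orthonormal_basis_def orthogonal_def)
  qed
qed

section \<open>Matrices of projections\<close>

definition orthonormal_set :: "'a::real_inner set \<Rightarrow> bool" where
  "orthonormal_set B \<longleftrightarrow> pairwise orthogonal B \<and> (\<forall>b\<in>B. norm b = 1)"

lemma orthonormal_set_independent:
  fixes B :: "'a::euclidean_space set"
  shows "orthonormal_set B \<Longrightarrow> independent B"
  unfolding orthonormal_set_def by (intro pairwise_orthogonal_independent) auto

lemma norm_orth_proj_span:
  fixes B :: "(real ^ 'n) set"
  assumes B: "orthonormal_set B"
  shows "(norm (orth_proj (span B) x))\<^sup>2 = (\<Sum>b\<in>B. dyad b) \<bullet> dyad x"
proof -
  have fin: "finite B"
    using orthonormal_set_independent[OF B] by (rule independent_imp_finite)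
  define y where "y = (\<Sum>b\<in>B. (b \<bullet> x) *\<^sub>R b)"
  have yb: "y \<bullet> b = b \<bullet> x" if "b \<in> B" for b
  proof -
    have "y \<bullet> b = (\<Sum>a\<in>B. if a = b then b \<bullet> x else 0)"
      unfolding y_def inner_sum_left using B that
      by (intro sum.cong) (auto simp: orthonormal_set_def pairwise_def orthogonal_def norm_eq_1)
    then show ?thesis
      using fin that by simp
  qed
  have "orth_proj (span B) x = y"
  proof (rule orth_proj_unique)
    show "y \<in> span B"
      unfolding y_def by (intro span_sum span_scale span_base)
    show "orthogonal (x - y) z" if "z \<in> span B" for z
      using that
    proof (rule orthogonal_to_span)
      show "orthogonal (x - y) b" if "b \<in> B" for b
        using yb[OF that] by (simp add: orthogonal_def inner_diff_left inner_commute[of x b])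
    qed
  qed simp
  moreover have "y \<bullet> y = (\<Sum>b\<in>B. (b \<bullet> x)\<^sup>2)"
  proof -
    have "y \<bullet> y = (\<Sum>b\<in>B. (b \<bullet> x) * (y \<bullet> b))"
      by (subst (2) y_def) (simp add: inner_sum_right)
    then show ?thesis
      using yb by (simp add: power2_eq_square)
  qed
  ultimately show ?thesis
    by (simp add: power2_norm_eq_inner inner_sum_left dyad_inner_dyad)
qed

lemma subspace_orthonormal_span:
  fixes L :: "'a::euclidean_space set"
  assumes "subspace L"
  obtains B where "orthonormal_set B" "card B = dim L" "span B = L"
  using orthonormal_basis_subspace[OF assms] that unfolding orthonormal_set_def by metis

lemma orthonormal_set_extend_unit:
  fixes u :: "'a::euclidean_space"
  assumes "norm u = 1" "m \<le> DIM('a)" "1 \<le> m"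
  obtains B where "orthonormal_set B" "u \<in> B" "card B = m"
proof -
  have "subspace {x. orthogonal u x}" by (rule subspace_orthogonal_to_vector)
  then obtain C where C: "orthonormal_set C" "card C = dim {x. orthogonal u x}"
      "span C = {x. orthogonal u x}"
    by (rule subspace_orthonormal_span)
  have "u \<noteq> 0" using assms(1) by auto
  then have "card C = DIM('a) - 1"
    using C(2) dim_hyperplane[of u] by (simp add: orthogonal_def)
  then obtain C' where C': "C' \<subseteq> C" "card C' = m - 1"
    using assms(2) obtain_subset_with_card_n[of "m - 1" C] by (metis diff_le_mono)
  have orth: "orthogonal u x" if "x \<in> C'" for x
    using that C' C(3) span_base[of x C] by auto
  have "u \<notin> C'"
    using orth[of u] \<open>u \<noteq> 0\<close> by (auto simp: orthogonal_def)
  have fin: "finite C'"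
    using C(1) C'(1) finite_subset independent_imp_finite orthonormal_set_independent by blast
  show thesis
  proof
    show "orthonormal_set (insert u C')"
      using C(1) C'(1) orth assms(1)
      by (auto simp: orthonormal_set_def pairwise_insert orthogonal_commute
          intro: pairwise_subset)
    show "card (insert u C') = m"
      using fin \<open>u \<notin> C'\<close> C'(2) assms(3) by simp
  qed simp
qed

text \<open>The matrices of the orthogonal projections of rank \<open>k\<close>. For a projection matrix \<open>M\<close> the
  squared norm of the projection of \<open>x\<close> is \<open>x \<bullet> M x = M \<bullet> dyad x\<close>; this is the form in which
  the correspondence with subspaces is used.\<close>

definition proj_matrices :: "nat \<Rightarrow> (real ^ 'n ^ 'n) set" where
  "proj_matrices k = {\<Sum>b\<in>B. dyad b | B. orthonormal_set B \<and> card B = k}"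

lemma proj_matrices_Sym: "proj_matrices k \<subseteq> Sym_matrices"
  by (auto simp: proj_matrices_def intro!: subspace_sum[OF subspace_Sym_matrices] dyad_in_Sym)

lemma proj_matrices_trace: "M \<in> proj_matrices k \<Longrightarrow> M \<bullet> mat 1 = k"
  by (auto simp: proj_matrices_def orthonormal_set_def sum_dyads_inner_mat_1)

lemma proj_matrix_of_subspace:
  fixes L :: "(real ^ 'n) set"
  assumes "subspace L" "dim L = k"
  obtains M where "M \<in> proj_matrices k" "\<And>x. (norm (orth_proj L x))\<^sup>2 = M \<bullet> dyad x"
proof -
  obtain B where "orthonormal_set B" "card B = dim L" "span B = L"
    using subspace_orthonormal_span[OF assms(1)] .
  then show thesis
    using that[of "\<Sum>b\<in>B. dyad b"] norm_orth_proj_span[of B] assms(2)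
    unfolding proj_matrices_def by blast
qed

lemma subspace_of_proj_matrix:
  fixes M :: "real ^ 'n ^ 'n"
  assumes "M \<in> proj_matrices k"
  shows "\<exists>L. subspace L \<and> dim L = k \<and> (\<forall>x. (norm (orth_proj L x))\<^sup>2 = M \<bullet> dyad x)"
proof -
  obtain B where "orthonormal_set B" "card B = k" "M = (\<Sum>b\<in>B. dyad b)"
    using assms by (auto simp: proj_matrices_def)
  then show ?thesis
    using norm_orth_proj_span[of B] orthonormal_set_independent[of B]
    by (intro exI[of _ "span B"]) (simp add: dim_eq_card_independent)
qed

text \<open>Put a unit vector \<open>u\<close> into an orthonormal set \<open>B\<close> of \<open>k + 1 \<le> n\<close> vectors. The form of \<open>T\<close>
  sums to zero over \<open>B\<close> with any single element removed, so it takes at each element the value \<open>s\<close>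
  of its sum over \<open>B\<close>. Then \<open>s = (k + 1) s\<close>, and \<open>s = 0\<close> because \<open>k \<ge> 1\<close>.\<close>

lemma Sym_eq_0_if_orthogonal_proj_matrices:
  fixes T :: "real ^ 'n ^ 'n"
  assumes T: "T \<in> Sym_matrices" and k: "1 \<le> k" "k < CARD('n)"
    and 0: "\<And>M. M \<in> proj_matrices k \<Longrightarrow> T \<bullet> M = 0"
  shows "T = 0"
proof (rule Sym_eq_0_if_orthogonal_dyads[OF T])
  have unit: "T \<bullet> dyad u = 0" if u: "norm u = 1" for u
  proof -
    obtain B where B: "orthonormal_set B" "u \<in> B" "card B = k + 1"
      using orthonormal_set_extend_unit[OF u, of "k + 1"] k by auto
    have fin: "finite B"
      using B(3) card.infinite by fastforce
    define s where "s = (\<Sum>b\<in>B. T \<bullet> dyad b)"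
    have s: "T \<bullet> dyad b = s" if "b \<in> B" for b
    proof -
      have "orthonormal_set (B - {b})" "card (B - {b}) = k"
        using B that fin by (auto simp: orthonormal_set_def intro: pairwise_subset)
      then have "T \<bullet> (\<Sum>b\<in>B - {b}. dyad b) = 0"
        by (intro 0) (auto simp: proj_matrices_def)
      then show ?thesis
        using fin that by (simp add: s_def inner_sum_right sum.remove[of B b])
    qed
    have "s = (\<Sum>b\<in>B. s)"
      by (subst s_def) (simp add: s)
    then have "s = 0"
      using B(3) k by (simp add: algebra_simps)
    then show ?thesis
      using s[OF B(2)] by simp
  qed
  show "T \<bullet> dyad x = 0" for x
  proof (cases "x = 0")
    case False
    have "T \<bullet> dyad x = (norm x)\<^sup>2 * (T \<bullet> dyad (sgn x))"
      using False by (simp add: sgn_div_norm dyad_scaleR power_divide field_simps)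
    also have "\<dots> = 0"
      using unit[of "sgn x"] False by (simp add: norm_sgn)
    finally show ?thesis .
  qed (simp add: inner_dyad)
qed

lemma span_proj_matrices:
  assumes "1 \<le> k" "k < CARD('n)"
  shows "span (proj_matrices k :: (real ^ 'n ^ 'n) set) = Sym_matrices"
proof (rule ccontr)
  let ?P = "proj_matrices k :: (real ^ 'n ^ 'n) set"
  assume "span ?P \<noteq> Sym_matrices"
  moreover have "span ?P \<subseteq> Sym_matrices"
    by (intro span_minimal proj_matrices_Sym subspace_Sym_matrices)
  ultimately have "span ?P \<subset> span Sym_matrices"
    by (auto simp: span_eq_iff[THEN iffD2, OF subspace_Sym_matrices])
  then obtain T where T: "T \<noteq> 0" "T \<in> span Sym_matrices"
      "\<And>M. M \<in> span ?P \<Longrightarrow> orthogonal T M"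
    using orthogonal_to_subspace_exists_gen by blast
  have "T \<in> Sym_matrices"
    using T(2) by (simp add: span_eq_iff[THEN iffD2, OF subspace_Sym_matrices])
  then have "T = 0"
    using assms T(3) by (intro Sym_eq_0_if_orthogonal_proj_matrices)
      (auto simp: orthogonal_def span_base)
  with T(1) show False by simp
qed

section \<open>The spanning criterion\<close>

text \<open>Both directions concern a symmetric \<open>T\<close> that is orthogonal to \<open>1\<close> and to all \<open>M j\<close>: if these
  span, then \<open>S - 1\<close> is such a \<open>T\<close> and must vanish; if they do not, then a nonzero \<open>T\<close> is used to
  perturb the identity.\<close>

lemma forces_iff_span:
  fixes L :: "nat \<Rightarrow> (real ^ 'n) set" and M :: "nat \<Rightarrow> real ^ 'n ^ 'n"
  assumes M: "\<And>j. j \<in> {1..N} \<Longrightarrow> M j \<in> proj_matrices k"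
    and norm_M: "\<And>j x. j \<in> {1..N} \<Longrightarrow> (norm (orth_proj (L j) x))\<^sup>2 = M j \<bullet> dyad x"
  shows "forces_orthonormal_basis k N L \<longleftrightarrow> span (insert (mat 1) (M ` {1..N})) = Sym_matrices"
    (is "?F \<longleftrightarrow> span ?G = _")
proof -
  have proj: "(\<Sum>i\<in>UNIV. (norm (orth_proj (L j) (e i)))\<^sup>2) = M j \<bullet> (\<Sum>i\<in>UNIV. dyad (e i))"
    if "j \<in> {1..N}" for j and e :: "'n \<Rightarrow> real ^ 'n"
    using norm_M[OF that] by (simp add: inner_sum_right)
  have mat1: "(mat 1 :: real ^ 'n ^ 'n) \<bullet> mat 1 = CARD('n)"
    by (simp add: inner_vec_def mat_def if_distrib cong: if_cong)
  have sub: "span ?G \<subseteq> Sym_matrices"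
    using M proj_matrices_Sym mat_1_in_Sym by (intro span_minimal subspace_Sym_matrices) blast
  show ?thesis
  proof
    assume span: "span ?G = Sym_matrices"
    show ?F
      unfolding forces_orthonormal_basis_def
    proof (intro allI impI)
      fix e :: "'n \<Rightarrow> real ^ 'n"
      assume e: "(\<forall>i. norm (e i) = 1) \<and>
        (\<forall>j\<in>{1..N}. (\<Sum>i\<in>UNIV. (norm (orth_proj (L j) (e i)))\<^sup>2) = real k)"
      define T where "T = (\<Sum>i\<in>UNIV. dyad (e i)) - mat 1"
      have "T \<in> Sym_matrices"
        unfolding T_def by (intro subspace_diff subspace_sum subspace_Sym_matrices dyad_in_Sym mat_1_in_Sym)
      moreover have "orthogonal T X" if X: "X \<in> ?G" for X
      proof (cases "X = mat 1")
        case True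
        then show ?thesis
          using e mat1
          by (simp add: T_def orthogonal_def inner_diff_left sum_dyads_inner_mat_1)
      next
        case False
        then obtain j where j: "j \<in> {1..N}" "X = M j"
          using X by auto
        then have "M j \<bullet> (\<Sum>i\<in>UNIV. dyad (e i)) = k"
          using e proj[of j e] by auto
        then show ?thesis
          using proj_matrices_trace[OF M[OF j(1)]] j(2)
          by (simp add: T_def orthogonal_def inner_diff_left inner_diff_right inner_commute[of _ "M j"])
      qed
      ultimately have "orthogonal T T"
        using span by (metis orthogonal_to_span)
      then have "T = 0"
        by (simp add: orthogonal_def)
      then show "orthonormal_basis e"
        using e by (subst orthonormal_basis_iff_sum_dyads) (auto simp: T_def)
    qed
  next
    assume F: ?F
    show "span ?G = Sym_matrices"
    proof (rule ccontr)
      assume "span ?G \<noteq> Sym_matrices"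
      with sub have "span ?G \<subset> span Sym_matrices"
        by (auto simp: span_eq_iff[THEN iffD2, OF subspace_Sym_matrices])
      then obtain T where T0: "T \<noteq> 0" and "T \<in> span Sym_matrices"
          and orth: "\<And>X. X \<in> span ?G \<Longrightarrow> orthogonal T X"
        using orthogonal_to_subspace_exists_gen by blast
      then have T: "T \<in> Sym_matrices"
        by (simp add: span_eq_iff[THEN iffD2, OF subspace_Sym_matrices])
      \<comment> \<open>The quadratic form of \<open>T\<close> is bounded by \<open>norm T\<close> on unit vectors, so this factor
        keeps \<open>S\<close> positive semidefinite.\<close>
      define S where "S = mat 1 + (1 / norm T) *\<^sub>R T"
      have S: "S \<in> Sym_matrices"
        unfolding S_def
        by (intro subspace_add subspace_scale subspace_Sym_matrices mat_1_in_Sym T)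
      have S_nonneg: "0 \<le> S \<bullet> dyad x" for x
      proof -
        have "\<bar>T \<bullet> dyad x\<bar> \<le> norm T * (norm x)\<^sup>2"
          using Cauchy_Schwarz_ineq2[of T "dyad x"] by (simp add: norm_dyad)
        then have "\<bar>(T \<bullet> dyad x) / norm T\<bar> \<le> (norm x)\<^sup>2"
          using T0 by (simp add: field_simps)
        then show ?thesis
          unfolding abs_le_iff by (simp add: S_def inner_add_left mat_1_inner_dyad)
      qed
      have S_inner: "S \<bullet> X = mat 1 \<bullet> X" if "X \<in> ?G" for X
        using orth[OF span_base[OF that]] by (simp add: S_def inner_add_left orthogonal_def)
      obtain e :: "'n \<Rightarrow> real ^ 'n" where e: "\<And>i. norm (e i) = 1" "S = (\<Sum>i\<in>UNIV. dyad (e i))"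
        using psd_eq_sum_unit_dyads[OF S S_nonneg] S_inner[of "mat 1"] mat1 by auto
      have "(\<Sum>i\<in>UNIV. (norm (orth_proj (L j) (e i)))\<^sup>2) = k" if "j \<in> {1..N}" for j
        unfolding proj[OF that] e(2)[symmetric]
        using S_inner[of "M j"] proj_matrices_trace[OF M[OF that]] that
        by (simp add: inner_commute)
      then have "orthonormal_basis e"
        using F e(1) unfolding forces_orthonormal_basis_def by blast
      then have "S = mat 1"
        using orthonormal_basis_iff_sum_dyads[OF e(1)] e(2) by simp
      then show False
        using T0 by (simp add: S_def)
    qed
  qed
qed

section \<open>The least number of subspaces\<close>

theorem theorem5p2:
  fixes n k D :: nat
  assumes "n = CARD('n::finite)"
    and "1 \<le> k" and "k \<le> n - 1"
    and "D = dim (Sym_matrices :: (real ^ 'n ^ 'n) set)"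
  shows "D = n * (n + 1) div 2 \<and>
         admissible TYPE('n) k (D - 1) \<and>
         (\<forall>N. admissible TYPE('n) k N \<longrightarrow> D - 1 \<le> N)"
proof (intro conjI allI impI)
  show "D = n * (n + 1) div 2"
    using assms(1,4) dim_Sym_matrices by simp
next
  let ?I = "mat 1 :: real ^ 'n ^ 'n" and ?P = "proj_matrices k :: (real ^ 'n ^ 'n) set"
  have k: "k < CARD('n)" using assms(1-3) by linarith
  have "?I \<noteq> 0" by (simp add: mat_def vec_eq_iff)
  then obtain B where B: "{?I} \<subseteq> B" "B \<subseteq> insert ?I ?P" "independent B" "insert ?I ?P \<subseteq> span B"
    using maximal_independent_subset_extend[of "{?I}" "insert ?I ?P"] by auto
  have fin: "finite B" using B(3) by (rule independent_imp_finite)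
  have "span B = span (insert ?I ?P)"
    by (intro antisym span_mono B(2) span_minimal[OF B(4)]) simp
  also have "\<dots> = Sym_matrices"
    using span_proj_matrices[OF assms(2) k] mat_1_in_Sym
    by (metis span_redundant)
  finally have span: "span B = Sym_matrices" .
  have "card B = D"
    using B(3) span assms(4) by (metis dim_span_eq_card_independent dim_span)
  then have card: "card (B - {?I}) = D - 1"
    using B(1) fin by simp
  obtain M where M: "bij_betw M {1..D - 1} (B - {?I})"
    using ex_bij_betw_nat_finite_1[of "B - {?I}"] fin card by auto
  have MB: "M ` {1..D - 1} = B - {?I}"
    using M by (rule bij_betw_imp_surj_on)
  have MP: "M j \<in> ?P" if "j \<in> {1..D - 1}" for j
    using MB B(2) that by blast
  have "\<forall>j\<in>{1..D - 1}. \<exists>L. subspace L \<and> dim L = k \<and>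
      (\<forall>x. (norm (orth_proj L x))\<^sup>2 = M j \<bullet> dyad x)"
    using subspace_of_proj_matrix MP by blast
  then obtain L where L: "\<And>j. j \<in> {1..D - 1} \<Longrightarrow> subspace (L j) \<and> dim (L j) = k \<and>
      (\<forall>x. (norm (orth_proj (L j) x))\<^sup>2 = M j \<bullet> dyad x)"
    by metis
  have "insert ?I (M ` {1..D - 1}) = B"
    using MB B(1) by auto
  then have "forces_orthonormal_basis k (D - 1) L"
    using forces_iff_span[of "D - 1" M k L] MP L span by simp
  then show "admissible TYPE('n) k (D - 1)"
    using L unfolding admissible_def by blast
next
  fix N assume "admissible TYPE('n) k N"
  then obtain L :: "nat \<Rightarrow> (real ^ 'n) set" where
    L: "\<And>j. j \<in> {1..N} \<Longrightarrow> subspace (L j) \<and> dim (L j) = k" and F: "forces_orthonormal_basis k N L"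
    unfolding admissible_def by blast
  have "\<forall>j\<in>{1..N}. \<exists>M. M \<in> proj_matrices k \<and> (\<forall>x. (norm (orth_proj (L j) x))\<^sup>2 = M \<bullet> dyad x)"
    using L proj_matrix_of_subspace by metis
  then obtain M where M: "\<And>j. j \<in> {1..N} \<Longrightarrow> M j \<in> proj_matrices k \<and>
      (\<forall>x. (norm (orth_proj (L j) x))\<^sup>2 = M j \<bullet> dyad x)"
    by metis
  have "span (insert (mat 1) (M ` {1..N})) = Sym_matrices"
    using forces_iff_span[of N M k L] M F by blast
  then have "D \<le> card (insert (mat 1) (M ` {1..N}))"
    using assms(4) dim_le_card[of Sym_matrices "insert (mat 1) (M ` {1..N})"] by simp
  also have "\<dots> \<le> Suc (card (M ` {1..N}))"
    by (rule card_insert_le_m1) auto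
  also have "\<dots> \<le> Suc N"
    using card_image_le[of "{1..N}" M] by simp
  finally show "D - 1 \<le> N" by simp
qed

end
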